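(* Let $K$ be a radicable and $\sigma$-complete (commutative, infinite) idempotent semifield, and let $p, q \in K[X]$. If $q_0 = 0$ and the inequality $\widehat{p}(x) \leqslant \widehat{q}(x)$ has a solution in $K$, then the equation $\widehat{p}(x) = \widehat{q}(x)$ has a solution in $K$.
   Context: A semiring is a commutative monoid $(S,+,0)$ with an associative multiplication having identity $1$, distributing over $+$, and with $0$ absorbing. A semifield is a semiring with $1\neq 0$ in which every nonzero element has a multiplicative inverse; it is idempotent if $x+x=x$ for all $x$. All idempotent semifields are assumed commutative and infinite. An idempotent semifield $K$ is ordered by $x\leqslant y \iff x+y=y$. $\mathbb{N}$ contains $0$ and $\mathbb{N}^*=\mathbb{N}\setminus\{0\}$. $K$ is radicable if for all $y\in K$, $n\in\mathbb{N}^*$ there is $x\in K$ with $x^n=y$. $K$ is $\sigma$-complete if every countable subset of $K$ that is bounded above has a supremum. A polynomial $p\in K[X]$ is a formal polynomial $p=\sum_{j\in\mathbb{N}}p_jX^j$ (eventually zero sequence of coefficients), with polynomial function $\widehat p:K\to K$, $\widehat p(x)=\sum_j p_jx^j$. *)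

theory Defs
  imports
    "HOL-Computational_Algebra.Polynomial"
    "HOL-Library.Countable_Set"
    "HOL-Library.Lub_Glb"
begin

(* Commutativity of multiplication and 0 \<noteq> 1 are part of comm_semiring_1; the order is
   not independent data but is fixed by addition (le_iff_add_eq). *)
class idempotent_semifield = comm_semiring_1 + ord +
  assumes ex_mult_inverse: "x \<noteq> 0 \<Longrightarrow> \<exists>y. x * y = 1"
    and add_idem: "x + x = x"
    and le_iff_add_eq: "x \<le> y \<longleftrightarrow> x + y = y"
    and less_iff_le_neq: "x < y \<longleftrightarrow> x \<le> y \<and> x \<noteq> y"
begin

subclass order
proof
  show "x \<le> x" for x
    by (simp add: le_iff_add_eq add_idem)
  show antisym: "x = y" if "x \<le> y" "y \<le> x" for x y
    using that by (metis le_iff_add_eq add.commute)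
  show "x \<le> z" if "x \<le> y" "y \<le> z" for x y z
    using that by (metis le_iff_add_eq add.assoc)
  show "x < y \<longleftrightarrow> x \<le> y \<and> \<not> y \<le> x" for x y
    using antisym by (metis less_iff_le_neq le_iff_add_eq add_idem)
qed

end

definition radicable :: "'a::idempotent_semifield itself \<Rightarrow> bool" where
  "radicable _ \<longleftrightarrow> (\<forall>(y::'a) (n::nat). n > 0 \<longrightarrow> (\<exists>x. x ^ n = y))"

definition sigma_complete :: "'a::idempotent_semifield itself \<Rightarrow> bool" where
  "sigma_complete _ \<longleftrightarrow>
     (\<forall>A :: 'a set. countable A \<longrightarrow> bdd_above A \<longrightarrow> (\<exists>s. isLub UNIV A s))"

end

theory Submission
  imports Defs
begin

text \<open>
  If \<open>q = 0\<close>, any solution of the inequality already solves the equation. Otherwise, since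
  \<open>q\<^sub>0 = 0\<close>, the polynomial function of \<open>q\<close> is an order automorphism of \<open>K\<close>: it reflects
  the order because \<open>t * q(x) \<le> q(t * x)\<close> for \<open>t \<ge> 1\<close>, and it is onto by taking roots of the
  coefficients. Hence one can iterate \<open>q(x\<^bsub>n+1\<^esub>) = p(x\<^sub>n)\<close> from \<open>x\<^sub>0 = 0\<close>. The sequence increases
  and stays below every solution of \<open>p(x) \<le> q(x)\<close>; as polynomial functions commute with
  suprema of increasing sequences, its supremum solves \<open>p(x) = q(x)\<close>.
\<close>

section \<open>Order and arithmetic in idempotent semifields\<close>

context idempotent_semifield
begin

subclass canonically_ordered_monoid_add
proof
  show "a \<le> b \<longleftrightarrow> (\<exists>c. b = a + c)" for a b
    by (metis le_iff_add_eq add.assoc add_idem)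
qed

subclass ordered_comm_semiring
proof
  show "c * a \<le> c * b" if "a \<le> b" for a b c
    using that by (metis le_iff_add_eq distrib_left)
qed

lemma add_le_iff: "x + y \<le> u \<longleftrightarrow> x \<le> u \<and> y \<le> u"
proof
  assume "x + y \<le> u"
  then have "x + y + u = u"
    by (simp add: le_iff_add_eq)
  then show "x \<le> u \<and> y \<le> u"
    by (metis le_iff_add_eq add.assoc add.commute add_idem)
next
  assume "x \<le> u \<and> y \<le> u"
  then show "x + y \<le> u"
    by (metis le_iff_add_eq add.assoc)
qed

lemma le_add_left: "x \<le> x + y" and le_add_right: "y \<le> x + y"
  using add_le_iff by blast+

lemma sum_le_iff: "finite A \<Longrightarrow> sum f A \<le> u \<longleftrightarrow> (\<forall>a\<in>A. f a \<le> u)"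
  by (induction A rule: finite_induct) (auto simp: add_le_iff)

lemma mult_le_mult: "a \<le> b \<Longrightarrow> c \<le> d \<Longrightarrow> a * c \<le> b * d"
  by (rule mult_mono) auto

lemma pow_mono: "a \<le> b \<Longrightarrow> a ^ n \<le> b ^ n"
  by (induction n) (auto intro: mult_le_mult)

text \<open>Idempotence absorbs repeated summands; this removes the binomial coefficients in
  \<open>power_add_eq\<close>.\<close>

lemma of_nat_mult_le: "of_nat n * x \<le> x"
  by (induction n) (auto simp: add_le_iff distrib_right)

lemma mult_le_cancel_left:
  assumes "c \<noteq> 0"
  shows "c * x \<le> c * y \<longleftrightarrow> x \<le> y"
proof
  obtain d where d: "d * c = 1"
    using ex_mult_inverse[OF assms] by (auto simp: mult.commute)
  assume "c * x \<le> c * y"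
  then have "d * (c * x) \<le> d * (c * y)"
    by (rule mult_le_mult[OF order_refl])
  then show "x \<le> y"
    by (simp add: d flip: mult.assoc)
qed (simp add: mult_le_mult)

lemma mult_eq_0: "x * y = 0 \<longleftrightarrow> x = 0 \<or> y = 0"
  using mult_le_cancel_left[of x y 0] by auto

lemma power_eq_0: "x ^ n = 0 \<Longrightarrow> x = 0"
  by (induction n) (auto simp: mult_eq_0)

lemma one_le_power: "1 \<le> t \<Longrightarrow> 1 \<le> t ^ n"
  using pow_mono[of 1 t n] by simp

lemma power_antimono:
  assumes "a \<le> 1" "j \<le> n"
  shows "a ^ n \<le> a ^ j"
proof -
  have "a ^ n = a ^ j * a ^ (n - j)"
    using assms by (simp flip: power_add)
  also have "\<dots> \<le> a ^ j * 1"
    using pow_mono[OF assms(1), of "n - j"] by (intro mult_le_mult) auto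
  finally show ?thesis by simp
qed

text \<open>The Frobenius identity, here in every exponent. The upper bound is proved after
  multiplication by \<open>(x + y) ^ n\<close>, by expanding \<open>(x + y) ^ (n + n)\<close>; the
  factor is then cancelled, which requires \<open>x + y \<noteq> 0\<close>.\<close>

lemma power_add_eq: "(x + y) ^ n = x ^ n + y ^ n"
proof (rule order.antisym)
  show "x ^ n + y ^ n \<le> (x + y) ^ n"
    by (simp add: add_le_iff pow_mono le_add_left le_add_right)
  show "(x + y) ^ n \<le> x ^ n + y ^ n"
  proof (cases "x + y = 0")
    case True
    then show ?thesis
      by (metis add_le_iff add_idem le_zero_eq order_refl)
  next
    case False
    have mono: "x ^ a * y ^ b \<le> (x + y) ^ n" if "a + b = n" for a b
      unfolding that[symmetric] power_add
      by (intro mult_le_mult pow_mono le_add_left le_add_right)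
    \<comment> \<open>every monomial of degree \<open>2 n\<close> is divisible by \<open>x ^ n\<close> or by \<open>y ^ n\<close>\<close>
    have "x ^ k * y ^ (n + n - k) \<le> (x + y) ^ n * (x ^ n + y ^ n)" if "k \<le> n + n" for k
    proof (cases "n \<le> k")
      case True
      then have "x ^ k * y ^ (n + n - k) = (x ^ (k - n) * y ^ (n + n - k)) * x ^ n"
        by (metis le_add_diff_inverse power_add mult.assoc mult.commute)
      also have "\<dots> \<le> (x + y) ^ n * (x ^ n + y ^ n)"
        using True that by (intro mult_le_mult mono le_add_left) auto
      finally show ?thesis .
    next
      case False
      then have "n + n - k = (n - k) + n"
        by simp
      then have "x ^ k * y ^ (n + n - k) = (x ^ k * y ^ (n - k)) * y ^ n"
        by (simp only: power_add mult.assoc)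
      also have "\<dots> \<le> (x + y) ^ n * (x ^ n + y ^ n)"
        using False by (intro mult_le_mult mono le_add_right) auto
      finally show ?thesis .
    qed
    then have "(x + y) ^ (n + n) \<le> (x + y) ^ n * (x ^ n + y ^ n)"
      unfolding binomial_ring
      by (auto simp: sum_le_iff mult.assoc intro: order.trans[OF of_nat_mult_le])
    then have "(x + y) ^ n * (x + y) ^ n \<le> (x + y) ^ n * (x ^ n + y ^ n)"
      unfolding power_add .
    then show ?thesis
      using False power_eq_0 mult_le_cancel_left by blast
  qed
qed

text \<open>The exponent is positive because an empty sum would give \<open>0 ^ 0 = 1\<close> on the
  left and \<open>0\<close> on the right.\<close>

lemma power_sum_eq:
  assumes "n > 0"
  shows "(\<Sum>a\<in>A. f a) ^ n = (\<Sum>a\<in>A. f a ^ n)"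
  using assms by (induction A rule: infinite_finite_induct) (auto simp: power_add_eq zero_power)

end

section \<open>Polynomial functions: additivity, order reflection, surjectivity\<close>

lemma poly_mono:
  fixes p :: "'a::idempotent_semifield poly"
  shows "x \<le> y \<Longrightarrow> poly p x \<le> poly p y"
  by (induction p) (auto intro!: add_mono mult_le_mult)

lemma poly_add_arg:
  fixes p :: "'a::idempotent_semifield poly"
  shows "poly p (x + y) = poly p x + poly p y"
  by (simp add: poly_altdef power_add_eq distrib_left sum.distrib)

lemma poly_eq_0_imp_eq_0:
  fixes q :: "'a::idempotent_semifield poly"
  assumes "q \<noteq> 0" "poly q x = 0"
  shows "x = 0"
proof -
  have "lead_coeff q * x ^ degree q \<le> poly q x"
    unfolding poly_altdef by (rule member_le_sum) auto
  then have "lead_coeff q * x ^ degree q = 0"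
    using assms by simp
  then show ?thesis
    using assms(1) by (auto simp: mult_eq_0 dest: power_eq_0)
qed

text \<open>For \<open>s \<noteq> 0\<close> let \<open>t \<ge> 1\<close> be the quotient of
  \<open>s + w\<close> by \<open>s\<close>. Then
  \<open>poly q s * t \<le> poly q (s * t) = poly q s\<close>, and cancelling the nonzero
  \<open>poly q s\<close> gives \<open>t \<le> 1\<close>, so \<open>s + w \<le> s\<close>.\<close>

lemma poly_le_imp_le:
  fixes q :: "'a::idempotent_semifield poly"
  assumes "q \<noteq> 0" "coeff q 0 = 0" "poly q w \<le> poly q s"
  shows "w \<le> s"
proof -
  \<comment> \<open>The order need not be total; replacing \<open>w\<close> by \<open>s + w\<close>
    gives an element comparable with \<open>s\<close>.\<close>
  have eq: "poly q (s + w) = poly q s"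
    using assms(3) by (metis poly_add_arg add.commute le_iff_add_eq)
  show ?thesis
  proof (cases "s = 0")
    case True
    then have "poly q w = 0"
      using eq assms(2) by (simp add: poly_0_coeff_0)
    then have "w = 0"
      using poly_eq_0_imp_eq_0 assms(1) by blast
    then show ?thesis by simp
  next
    case False
    then obtain r where r: "s * r = 1"
      using ex_mult_inverse by blast
    define t where "t = (s + w) * r"
    have t1: "1 \<le> t"
      using r by (simp add: t_def distrib_right le_add_left)
    have st: "s * t = s + w"
      using r by (metis t_def mult.assoc mult.commute mult_1_left)
    have "poly q s * t = (\<Sum>j\<le>degree q. coeff q j * s ^ j * t)"
      by (simp add: poly_altdef sum_distrib_right)
    also have "\<dots> \<le> (\<Sum>j\<le>degree q. coeff q j * s ^ j * t ^ j)"
    proof (rule sum_mono)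
      fix j
      show "coeff q j * s ^ j * t \<le> coeff q j * s ^ j * t ^ j"
      \<comment> \<open>The constant term vanishes, and \<open>t \<le> t ^ j\<close> for
        \<open>j > 0\<close> because \<open>1 \<le> t\<close>.\<close>
      proof (cases j)
        case 0
        then show ?thesis using assms(2) by simp
      next
        case (Suc i)
        have "t * 1 \<le> t * t ^ i"
          by (intro mult_le_mult one_le_power t1) auto
        then show ?thesis
          using Suc by (intro mult_le_mult) auto
      qed
    qed
    also have "\<dots> = poly q (s * t)"
      by (simp add: poly_altdef power_mult_distrib mult.assoc)
    also have "\<dots> = poly q s * 1"
      by (simp add: st eq)
    finally have "t \<le> 1"
      using False poly_eq_0_imp_eq_0 assms(1) mult_le_cancel_left by blast
    then have "s * t \<le> s * 1"
      by (intro mult_le_mult) auto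
    then show ?thesis
      by (simp add: st add_le_iff)
  qed
qed

text \<open>For \<open>y \<noteq> 0\<close>, writing each coefficient as \<open>y * v j ^ j\<close>
  reduces the equation to \<open>(\<Sum>j=1..N. (v j * z) ^ j) = 1\<close>, which the inverse
  \<open>z\<close> of the sum of the \<open>v j\<close> satisfies.\<close>

lemma poly_surj:
  fixes q :: "'a::idempotent_semifield poly"
  assumes rad: "radicable TYPE('a)" and "q \<noteq> 0" "coeff q 0 = 0"
  shows "\<exists>z. poly q z = y"
proof (cases "y = 0")
  case True
  then show ?thesis
    using assms(3) by (auto simp: poly_0_coeff_0 intro: exI[of _ 0])
next
  case False
  define N where "N = degree q"
  have "N \<noteq> 0"
    using assms(2,3) unfolding N_def by (metis leading_coeff_0_iff)
  obtain y' where y': "y * y' = 1"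
    using False ex_mult_inverse by blast
  have "\<exists>v. y * v ^ j = coeff q j" if j: "j > 0" for j
  proof -
    obtain v where "v ^ j = y' * coeff q j"
      using rad j unfolding radicable_def by blast
    then show ?thesis
      using y' by (metis mult.assoc mult_1_left)
  qed
  then obtain v where v: "y * v j ^ j = coeff q j" if "j > 0" for j
    by metis
  \<comment> \<open>The root for the leading coefficient keeps the sum of the \<open>v j\<close>
    nonzero, hence invertible.\<close>
  have "v N \<noteq> 0"
    using v[of N] \<open>N \<noteq> 0\<close> assms(2) by (auto simp: N_def power_0_left split: if_splits)
  moreover have "v N \<le> (\<Sum>j=1..N. v j)"
    using \<open>N \<noteq> 0\<close> by (intro member_le_sum) auto
  ultimately have "(\<Sum>j=1..N. v j) \<noteq> 0"
    by (metis le_zero_eq)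
  then obtain z where "(\<Sum>j=1..N. v j) * z = 1"
    using ex_mult_inverse by blast
  then have sum1: "(\<Sum>j=1..N. v j * z) = 1"
    by (simp add: sum_distrib_right)
  have le1: "v j * z \<le> 1" if "j \<in> {1..N}" for j
    using that sum_le_iff[of "{1..N}" "\<lambda>j. v j * z" 1] sum1 by auto
  have "(\<Sum>j=1..N. (v j * z) ^ j) = 1"
  proof (rule order.antisym)
    show "(\<Sum>j=1..N. (v j * z) ^ j) \<le> 1"
      using pow_mono[OF le1] by (simp add: sum_le_iff)
    \<comment> \<open>The top exponent \<open>N\<close> can be distributed over the sum; as
      \<open>v j * z \<le> 1\<close>, lowering it to \<open>j\<close> only enlarges each
      term.\<close>
    have "1 = (\<Sum>j=1..N. v j * z) ^ N"
      by (simp only: sum1 power_one)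
    also have "\<dots> = (\<Sum>j=1..N. (v j * z) ^ N)"
      using \<open>N \<noteq> 0\<close> by (simp add: power_sum_eq)
    also have "\<dots> \<le> (\<Sum>j=1..N. (v j * z) ^ j)"
      by (intro sum_mono power_antimono le1) auto
    finally show "1 \<le> (\<Sum>j=1..N. (v j * z) ^ j)" .
  qed
  moreover have "poly q z = (\<Sum>j=1..N. coeff q j * z ^ j)"
    unfolding poly_altdef N_def[symmetric]
    using assms(3) by (intro sum.mono_neutral_right) (auto simp: Suc_le_eq)
  moreover have "\<dots> = (\<Sum>j=1..N. y * (v j * z) ^ j)"
    using v by (intro sum.cong) (auto simp: power_mult_distrib simp flip: mult.assoc)
  ultimately show ?thesis
    by (auto simp flip: sum_distrib_left)
qed

section \<open>Suprema of sequences and their preservation by polynomial functions\<close>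

lemma isLub_range_iff:
  fixes f :: "'b \<Rightarrow> 'a::order"
  shows "isLub UNIV (range f) s \<longleftrightarrow> (\<forall>u. s \<le> u \<longleftrightarrow> (\<forall>n. f n \<le> u))"
proof -
  have "isLub UNIV (range f) s \<longleftrightarrow> (\<forall>n. f n \<le> s) \<and> (\<forall>u. (\<forall>n. f n \<le> u) \<longrightarrow> s \<le> u)"
    by (simp add: isLub_def leastP_def isUb_def setle_def setge_def)
  also have "\<dots> \<longleftrightarrow> (\<forall>u. s \<le> u \<longleftrightarrow> (\<forall>n. f n \<le> u))"
  proof (rule iffI, rule allI)
    fix u
    assume "(\<forall>n. f n \<le> s) \<and> (\<forall>u. (\<forall>n. f n \<le> u) \<longrightarrow> s \<le> u)"
    then show "s \<le> u \<longleftrightarrow> (\<forall>n. f n \<le> u)"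
      by (metis order.trans)
  qed blast
  finally show ?thesis .
qed

lemma isLub_range_least:
  fixes f :: "'b \<Rightarrow> 'a::order"
  shows "isLub UNIV (range f) s \<Longrightarrow> (\<And>n. f n \<le> u) \<Longrightarrow> s \<le> u"
  unfolding isLub_range_iff by iprover

lemma mult_le_iff_le_mult:
  fixes c d :: "'a::idempotent_semifield"
  assumes "c * d = 1"
  shows "c * x \<le> u \<longleftrightarrow> x \<le> d * u"
proof -
  have "c * (d * u) = u"
    using assms by (metis mult.assoc mult_1_left)
  moreover have "c \<noteq> 0"
    using assms by auto
  ultimately show ?thesis
    using mult_le_cancel_left[of c x "d * u"] by simp
qed

text \<open>For \<open>c \<noteq> 0\<close>, dividing an upper bound by \<open>c\<close> carries the
  defining equivalence of the supremum over.\<close>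

lemma isLub_range_mult_left:
  fixes f :: "nat \<Rightarrow> 'a::idempotent_semifield"
  assumes "isLub UNIV (range f) s"
  shows "isLub UNIV (range (\<lambda>n. c * f n)) (c * s)"
proof (cases "c = 0")
  case True
  then show ?thesis
    unfolding isLub_range_iff by simp
next
  case False
  then obtain d where "c * d = 1"
    using ex_mult_inverse by blast
  then show ?thesis
    using assms by (simp add: isLub_range_iff mult_le_iff_le_mult)
qed

text \<open>Monotonicity bounds the mixed product \<open>f m * g n\<close> by the diagonal one at
  \<open>max m n\<close>, so suprema can be taken in \<open>n\<close> and \<open>m\<close>
  separately.\<close>

lemma isLub_range_mult:
  fixes f g :: "nat \<Rightarrow> 'a::idempotent_semifield"
  assumes "mono f" "mono g" "isLub UNIV (range f) s" "isLub UNIV (range g) t"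
  shows "isLub UNIV (range (\<lambda>n. f n * g n)) (s * t)"
  unfolding isLub_range_iff
proof (intro allI iffI)
  fix u n
  assume "s * t \<le> u"
  moreover have "f n * g n \<le> s * t"
    by (intro mult_le_mult isLubD2[OF assms(3)] isLubD2[OF assms(4)]) auto
  ultimately show "f n * g n \<le> u" by simp
next
  fix u
  assume u: "\<forall>n. f n * g n \<le> u"
  have "f m * g n \<le> u" for m n
  proof -
    have "f m * g n \<le> f (max m n) * g (max m n)"
      using assms(1,2) by (intro mult_le_mult) (auto intro: monoD)
    then show ?thesis
      using u by (meson order.trans)
  qed
  then have "f m * t \<le> u" for m
    by (rule isLub_range_least[OF isLub_range_mult_left[OF assms(4)]])
  then have "t * f m \<le> u" for m
    by (simp add: mult.commute)
  then have "t * s \<le> u"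
    by (rule isLub_range_least[OF isLub_range_mult_left[OF assms(3)]])
  then show "s * t \<le> u"
    by (simp add: mult.commute)
qed

text \<open>Induction along the Horner form: products are handled by
  \<open>isLub_range_mult\<close>, the added constant by \<open>add_le_iff\<close>.\<close>

lemma isLub_range_poly:
  fixes f :: "nat \<Rightarrow> 'a::idempotent_semifield"
  assumes "mono f" "isLub UNIV (range f) s"
  shows "isLub UNIV (range (\<lambda>n. poly p (f n))) (poly p s)"
proof (induction p)
  case 0
  then show ?case
    unfolding isLub_range_iff by simp
next
  case (pCons a p)
  have "mono (\<lambda>n. poly p (f n))"
    using assms(1) by (auto simp: mono_def intro: poly_mono)
  then have "isLub UNIV (range (\<lambda>n. f n * poly p (f n))) (s * poly p s)"
    using assms pCons.IH by (intro isLub_range_mult)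
  then show ?case
    by (simp add: isLub_range_iff add_le_iff)
qed

theorem theorem7p6:
  fixes p q :: "'a::idempotent_semifield poly"
  assumes "infinite (UNIV :: 'a set)"
    and "radicable TYPE('a)"
    and "sigma_complete TYPE('a)"
    and "coeff q 0 = 0"
    and "\<exists>x. poly p x \<le> poly q x"
  shows "\<exists>x. poly p x = poly q x"
proof (cases "q = 0")
  case True
  then show ?thesis
    using assms(5) by auto
next
  case False
  obtain s where s: "poly p s \<le> poly q s"
    using assms(5) by blast
  obtain g where g: "poly q (g y) = y" for y
    using poly_surj[OF assms(2) False assms(4)] by metis
  \<comment> \<open>\<open>g\<close> is a right inverse of \<open>poly q\<close>. Starting at the
    least element \<open>0\<close> makes the base cases of both inductions below trivial.\<close>
  define x where "x = rec_nat 0 (\<lambda>_ a. g (poly p a))"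
  have x0: "x 0 = 0" and xs: "poly q (x (Suc n)) = poly p (x n)" for n
    by (simp_all add: x_def g)
  have le: "a \<le> b" if "poly q a \<le> poly q b" for a b
    using poly_le_imp_le[OF False assms(4) that] .
  have step: "x n \<le> x (Suc n)" for n
  proof (induction n)
    case (Suc n)
    show ?case
      by (rule le) (simp add: xs poly_mono Suc)
  qed (simp add: x0)
  then have mono: "mono x"
    by (simp add: incseq_SucI)
  have "x n \<le> s" for n
  proof (induction n)
    case (Suc n)
    \<comment> \<open>Here \<open>poly q (x (Suc n)) = poly p (x n) \<le> poly p s \<le> poly q
      s\<close>.\<close>
    show ?case
      by (rule le) (use order.trans[OF poly_mono[OF Suc] s] in \<open>simp add: xs\<close>)
  qed (simp add: x0)
  then have "bdd_above (range x)"
    by (intro bdd_aboveI[of _ s]) auto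
  moreover have "countable (range x)"
    by simp
  ultimately have "\<exists>z. isLub UNIV (range x) z"
    using assms(3)[unfolded sigma_complete_def, rule_format, of "range x"] by simp
  then obtain z where z: "isLub UNIV (range x) z" ..
  \<comment> \<open>Dropping the first term of an increasing sequence keeps its upper bounds; after
    the shift, the values of \<open>poly q\<close> are those of \<open>poly p\<close> along
    \<open>x\<close>.\<close>
  have "(\<forall>n. x (Suc n) \<le> u) \<longleftrightarrow> (\<forall>n. x n \<le> u)" for u
    using order.trans[OF step] by blast
  then have "isLub UNIV (range (\<lambda>n. x (Suc n))) z"
    using z unfolding isLub_range_iff by simp
  then have "isLub UNIV (range (\<lambda>n. poly q (x (Suc n)))) (poly q z)"
    using mono by (intro isLub_range_poly) (auto simp: mono_def)
  then have "isLub UNIV (range (\<lambda>n. poly p (x n))) (poly q z)"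
    unfolding xs .
  moreover have "isLub UNIV (range (\<lambda>n. poly p (x n))) (poly p z)"
    using isLub_range_poly[OF mono z] .
  \<comment> \<open>Both values are suprema of one sequence, hence equal.\<close>
  ultimately have "poly p z = poly q z"
    unfolding isLub_range_iff by (metis order.antisym order_refl)
  then show ?thesis
    by blast
qed

end
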